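(* For every integer $n\ge 1$, the triangle in the Pascal rhombus (mod 2) with corners at $[1,0]$, $[2^{n-1},-(2^{n-1}-1)]$ and $[2^{n-1},2^{n-1}-1]$ is identical to the triangle with corners at $[2^n+1,-2^n]$, $[2^n+2^{n-1},-(2^n+2^{n-1}-1)]$ and $[2^n+2^{n-1},-(2^n-2^{n-1}+1)]$, and is also identical to the triangle with corners at $[2^n+1,2^n]$, $[2^n+2^{n-1},2^n-2^{n-1}+1]$ and $[2^n+2^{n-1},2^n+2^{n-1}-1]$. That is, for all integers $i,j$ with $1\le i\le 2^{n-1}$ and $-i<j<i$, $$R[i,j]\equiv R[2^n+i,\,-2^n+j]\equiv R[2^n+i,\,2^n+j]\pmod 2.$$
   Context: The Pascal rhombus is the array of integers $R[n,k]$ ($n\ge 0$ an integer row index, $k\in\mathbb{Z}$ a column index) defined by $R[0,j]=0$ for all $j$, $R[1,0]=1$, $R[1,j]=0$ for $j\neq 0$, and $R[n,k]=R[n-1,k-1]+R[n-1,k]+R[n-1,k+1]+R[n-2,k]$ for $n\ge 2$ and all $k$. The notation $[n,k]$ denotes the cell in row $n$, column $k$. The non-zero entries are those with $-n<k<n$. The Pascal rhombus (mod 2) is the array of the entries $R[n,k]$ reduced modulo 2. *)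

theory Defs
  imports "HOL-Number_Theory.Cong"
begin

fun pascal_rhombus :: "nat \<Rightarrow> int \<Rightarrow> int" where
  "pascal_rhombus 0 k = 0"
| "pascal_rhombus (Suc 0) k = (if k = 0 then 1 else 0)"
| "pascal_rhombus (Suc (Suc n)) k =
     pascal_rhombus (Suc n) (k - 1) + pascal_rhombus (Suc n) k + pascal_rhombus (Suc n) (k + 1)
     + pascal_rhombus n k"

end

theory Submission
  imports Defs
begin

text \<open>
  Row \<open>n\<close> read as a Laurent polynomial in \<open>x\<close> is the Fibonacci polynomial \<open>F\<^sub>n(t)\<close> at
  \<open>t = x\<^sup>-\<^sup>1 + 1 + x\<close>. Modulo 2, \<open>F\<^bsub>m+i\<^esub> + F\<^bsub>m-i\<^esub> = t F\<^sub>m F\<^sub>i\<close>, and for \<open>m = 2^n\<close> the factor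
  \<open>t F\<^sub>m\<close> equals \<open>t^m = x^(-m) + 1 + x^m\<close>. Hence row \<open>m + i\<close> is the sum of row \<open>m - i\<close> and three
  copies of row \<open>i\<close>, shifted by \<open>-m\<close>, \<open>0\<close> and \<open>m\<close>; near the columns \<open>m\<close> and \<open>-m\<close> only one of these
  four summands is non-zero.
\<close>

lemma pascal_rhombus_eq_0:
  "int n \<le> \<bar>k\<bar> \<Longrightarrow> pascal_rhombus n k = 0"
  by (induction n k rule: pascal_rhombus.induct) auto

text \<open>Modulo 2 the recurrence reads the same upwards and downwards, so rows
  \<open>m + i\<close> and \<open>m - i\<close> together obey it in \<open>i\<close>, as does row
  \<open>i\<close>. Agreement at \<open>i = 0\<close> and, by \<open>tri\<close>, at
  \<open>i = 1\<close> therefore suffices.\<close>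

lemma pascal_rhombus_reflect:
  fixes m i :: nat and k :: int
  assumes tri: "\<And>k. even (pascal_rhombus m (k - 1) + pascal_rhombus m k + pascal_rhombus m (k + 1)
      + pascal_rhombus 1 (k - int m) + pascal_rhombus 1 k + pascal_rhombus 1 (k + int m))"
    and "i \<le> m"
  shows "even (pascal_rhombus (m + i) k + pascal_rhombus (m - i) k
      + pascal_rhombus i (k - int m) + pascal_rhombus i k + pascal_rhombus i (k + int m))"
  using \<open>i \<le> m\<close>
proof (induction i arbitrary: k rule: induct_nat_012)
  case 0
  then show ?case by simp
next
  case 1
  then obtain l where "m = Suc l"
    by (cases m) auto
  then show ?case
    using tri[of k] by (simp del: pascal_rhombus.simps(2) add: pascal_rhombus.simps(3)) argo
next
  case (ge2 i)
  define l where "l = m - Suc (Suc i)"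
  have l: "m - Suc (Suc i) = l" "m - Suc i = Suc l" "m - i = Suc (Suc l)"
    using ge2.prems by (auto simp: l_def)
  have low: "even (pascal_rhombus (m + i) k + pascal_rhombus (Suc (Suc l)) k
      + pascal_rhombus i (k - int m) + pascal_rhombus i k + pascal_rhombus i (k + int m))"
    using ge2.IH(1)[of k] ge2.prems l by simp
  have high: "even (pascal_rhombus (Suc (m + i)) k + pascal_rhombus (Suc l) k
      + pascal_rhombus (Suc i) (k - int m) + pascal_rhombus (Suc i) k
      + pascal_rhombus (Suc i) (k + int m))" for k
    using ge2.IH(2)[of k] ge2.prems l by simp
  have shift: "k - 1 - int m = k - int m - 1" "k + 1 - int m = k - int m + 1"
    "k - 1 + int m = k + int m - 1" "k + 1 + int m = k + int m + 1"
    by simp_all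
  show ?case
    \<comment> \<open>The three instances of \<open>high\<close> multiply by t; adding
      \<open>low\<close> completes the recurrence, run downwards on rows \<open>Suc (Suc l)\<close>,
      \<open>Suc l\<close>, \<open>l\<close>.\<close>
    using low high[of "k - 1"] high[of k] high[of "k + 1"]
    unfolding l shift add_Suc_right pascal_rhombus.simps(3) even_add by argo
qed

text \<open>Here \<open>pascal_rhombus 1\<close> serves as the indicator of column 0. Doubling
  \<open>m\<close> squares x^(-m) + 1 + x^m, which modulo 2 only doubles the exponents.\<close>

lemma pascal_rhombus_power2_row:
  fixes n :: nat and k :: int
  defines "m \<equiv> 2 ^ n :: nat"
  shows "even (pascal_rhombus m (k - 1) + pascal_rhombus m k + pascal_rhombus m (k + 1)
      + pascal_rhombus 1 (k - int m) + pascal_rhombus 1 k + pascal_rhombus 1 (k + int m))"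
  unfolding m_def
proof (induction n arbitrary: k)
  case 0
  show ?case by simp
next
  case (Suc n)
  define m :: nat where "m = 2 ^ n"
  note IH = Suc.IH[folded m_def]
  \<comment> \<open>Reflection at \<open>i = m\<close>: the mirrored row is row 0, which
    vanishes.\<close>
  have dbl: "even (pascal_rhombus (m + m) k
      + pascal_rhombus m (k - int m) + pascal_rhombus m k + pascal_rhombus m (k + int m))" for k
    using pascal_rhombus_reflect[OF IH order_refl, of k] by simp
  have shift: "k - 1 - int m = k - int m - 1" "k + 1 - int m = k - int m + 1"
    "k - 1 + int m = k + int m - 1" "k + 1 + int m = k + int m + 1"
    "k - int m + int m = k" "k + int m - int m = k"
    "k - int m - int m = k - int (m + m)" "k + int m + int m = k + int (m + m)"
    by simp_all
  have m2: "2 ^ Suc n = m + m"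
    by (simp add: m_def)
  show ?case
    \<comment> \<open>Multiply \<open>dbl\<close> by t, then replace each of the three shifts of t
      times row \<open>m\<close> by \<open>IH\<close>; the cross terms at distance \<open>m\<close>
      cancel in pairs.\<close>
    using dbl[of "k - 1"] dbl[of k] dbl[of "k + 1"] IH[of "k - int m"] IH[of k] IH[of "k + int m"]
    unfolding m2 shift even_add by argo
qed

theorem mainTheorem1:
  fixes n :: nat
  assumes "n \<ge> 1"
  shows "\<forall>(i::nat) (j::int). 1 \<le> i \<and> i \<le> 2 ^ (n - 1) \<and> - int i < j \<and> j < int i \<longrightarrow>
           [pascal_rhombus i j = pascal_rhombus (2 ^ n + i) (- (2 ^ n) + j)] (mod 2) \<and>
           [pascal_rhombus (2 ^ n + i) (- (2 ^ n) + j) = pascal_rhombus (2 ^ n + i) (2 ^ n + j)] (mod 2)"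
proof (intro allI impI)
  fix i :: nat and j :: int
  assume ij: "1 \<le> i \<and> i \<le> 2 ^ (n - 1) \<and> - int i < j \<and> j < int i"
  define m :: nat where "m = 2 ^ n"
  have "m = 2 * 2 ^ (n - 1)"
    using assms by (simp add: m_def flip: power_Suc)
  then have im: "2 * i \<le> m"
    using ij by simp
  have ref: "even (pascal_rhombus (m + i) k + pascal_rhombus (m - i) k
      + pascal_rhombus i (k - int m) + pascal_rhombus i k + pascal_rhombus i (k + int m))" for k
    using pascal_rhombus_reflect[OF pascal_rhombus_power2_row, of i n k] im by (simp add: m_def)
  \<comment> \<open>Since m - \<bar>j\<bar> > m - i \<ge> i by \<open>im\<close>, this column lies
    outside row \<open>m - i\<close> and outside the unshifted row \<open>i\<close>; the copy
    shifted to column m is further away still.\<close>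
  have left: "even (pascal_rhombus (m + i) (- int m + j) + pascal_rhombus i j)"
    using ref[of "- int m + j"] ij im by (simp add: pascal_rhombus_eq_0)
  have right: "even (pascal_rhombus (m + i) (int m + j) + pascal_rhombus i j)"
    using ref[of "int m + j"] ij im by (simp add: pascal_rhombus_eq_0)
  have "[pascal_rhombus i j = pascal_rhombus (m + i) (- int m + j)] (mod 2) \<and>
      [pascal_rhombus (m + i) (- int m + j) = pascal_rhombus (m + i) (int m + j)] (mod 2)"
    using left right unfolding cong_def by presburger
  then show "[pascal_rhombus i j = pascal_rhombus (2 ^ n + i) (- (2 ^ n) + j)] (mod 2) \<and>
      [pascal_rhombus (2 ^ n + i) (- (2 ^ n) + j) = pascal_rhombus (2 ^ n + i) (2 ^ n + j)] (mod 2)"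
    by (simp add: m_def)
qed

end
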